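(* Let $(X,d)$ be a Menger convex metric space. Then the following conditions (i)–(iv) are equivalent, and $X$ is strictly convex if and only if one (equivalently, each) of them is satisfied: (i) For all $x,y \in X$ and $p,q \in [x,y]$, we have $p \in [x,q]$ whenever $d(x,p) \leq d(x,q)$. (ii) For all $x, y \in X$ and $p,q \in [x,y]$, we have $p \in [x,q]$ or $q \in [x,p]$. (iii) For all $x, y \in X$, the set $\{ [x,p] : p \in [x,y] \}$ forms a chain under inclusion. (iv) Every metric segment $[x,y]$ in $X$ (with the metric induced from $X$) is isometrically embeddable into $\mathbb{R}$ with its Euclidean metric.
   Context: For a metric space $(X,d)$ and $x,y\in X$, the metric segment joining $x,y$ is $[x,y]=\{z\in X : d(x,z)+d(z,y)=d(x,y)\}$. The space $(X,d)$ is Menger convex if for all distinct $x,y\in X$ and all $\alpha\in[0,1]$ there exists $z_\alpha\in X$ with $d(x,z_\alpha)=\alpha d(x,y)$ and $d(z_\alpha,y)=(1-\alpha)d(x,y)$. It is strictly convex if for all distinct $x,y\in X$ and all $\alpha\in[0,1]$ there exists a unique such $z_\alpha\in X$. A chain under inclusion is a family of sets any two members of which are comparable under $\subseteq$. *)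

theory Defs
  imports "HOL-Analysis.Analysis"
begin

context Metric_space
begin

definition msegment :: "'a \<Rightarrow> 'a \<Rightarrow> 'a set" where
  "msegment x y = {z \<in> M. d x z + d z y = d x y}"

definition Menger_convex :: bool where
  "Menger_convex \<longleftrightarrow>
    (\<forall>x\<in>M. \<forall>y\<in>M. x \<noteq> y \<longrightarrow>
      (\<forall>\<alpha>\<in>{0..1}. \<exists>z\<in>M. d x z = \<alpha> * d x y \<and> d z y = (1 - \<alpha>) * d x y))"

definition strictly_convex :: bool where
  "strictly_convex \<longleftrightarrow>
    (\<forall>x\<in>M. \<forall>y\<in>M. x \<noteq> y \<longrightarrow>
      (\<forall>\<alpha>\<in>{0..1}. \<exists>!z. z \<in> M \<and> d x z = \<alpha> * d x y \<and> d z y = (1 - \<alpha>) * d x y))"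

end

definition isometrically_embeddable ::
    "'a set \<Rightarrow> ('a \<Rightarrow> 'a \<Rightarrow> real) \<Rightarrow> 'b set \<Rightarrow> ('b \<Rightarrow> 'b \<Rightarrow> real) \<Rightarrow> bool" where
  "isometrically_embeddable M1 d1 M2 d2 \<longleftrightarrow>
    (\<exists>f \<in> M1 \<rightarrow> M2. \<forall>p\<in>M1. \<forall>q\<in>M1. d2 (f p) (f q) = d1 p q)"

end

theory Submission
  imports Defs
begin

text \<open>
  In a Menger convex space, all the conditions say that a point of a segment \<open>[x,y]\<close> is determined
  by its distance from \<open>x\<close>, so that \<open>z \<mapsto> d x z\<close> is a faithful coordinate on \<open>[x,y]\<close>. The
  equivalences among the four conditions are proved for each segment separately. The basic fact is that betweenness is transitive: \<open>q \<in> [x,y]\<close> implies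
  \<open>[x,q] \<subseteq> [x,y]\<close>. It turns ``\<open>p \<in> [x,q]\<close>'' into ``\<open>[x,p] \<subseteq> [x,q]\<close>'', which links the
  chain condition to the others. If \<open>p \<in> [x,q]\<close> whenever \<open>d x p \<le> d x q\<close>, then
  \<open>d p q = \<bar>d x p - d x q\<bar>\<close>, so the coordinate is an isometry into the line; conversely,
  an isometry into the line maps \<open>[x,y]\<close> between the images of \<open>x\<close> and \<open>y\<close>, and there the
  claim is about order on \<open>\<real>\<close>.

  Menger convexity links uniqueness of points at a given distance to the rest. Two points at the same
  distance from \<open>x\<close> coincide once one lies between \<open>x\<close> and the other, which gives uniqueness,
  while existence is Menger convexity itself.
  Conversely, given \<open>p, q \<in> [x,y]\<close> with \<open>d x p \<le> d x q\<close>, convexity provides a point \<open>r \<in> [x,q]\<close>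
  at distance \<open>d x p\<close> from \<open>x\<close>; by transitivity \<open>r\<close> competes with \<open>p\<close> on \<open>[x,y]\<close>, so
  uniqueness forces \<open>p = r \<in> [x,q]\<close>.
\<close>

context Metric_space
begin

lemma msegment_iff: "z \<in> msegment x y \<longleftrightarrow> z \<in> M \<and> d x z + d z y = d x y"
  by (simp add: msegment_def)

lemma right_end_in_msegment: "y \<in> M \<Longrightarrow> y \<in> msegment x y"
  by (simp add: msegment_iff)

lemma left_end_in_msegment: "x \<in> M \<Longrightarrow> x \<in> msegment x y"
  by (simp add: msegment_iff)

text \<open>
  The chain \<open>d x y \<le> d x z + d z y \<le> d x z + d z q + d q y = d x q + d q y = d x y\<close> collapses
  to equalities.
\<close>
lemma msegment_mono:
  assumes "x \<in> M" "y \<in> M" "q \<in> msegment x y"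
  shows "msegment x q \<subseteq> msegment x y"
proof
  fix z assume z: "z \<in> msegment x q"
  then have "d z y \<le> d z q + d q y" and "d x y \<le> d x z + d z y"
    using assms by (auto simp: msegment_iff intro: triangle)
  then show "z \<in> msegment x y"
    using z assms(3) by (auto simp: msegment_iff)
qed

text \<open>
  If \<open>q\<close> lies between \<open>x\<close> and \<open>p\<close> without being nearer to \<open>x\<close>, there is no room left between
  \<open>q\<close> and \<open>p\<close>.
\<close>
lemma msegment_far_point_eq:
  assumes "p \<in> M" "q \<in> msegment x p" "d x p \<le> d x q"
  shows "q = p"
proof -
  have "d q p \<le> 0"
    using assms by (simp add: msegment_iff)
  then show ?thesis
    using assms by (metis msegment_iff mdist_pos_less not_less)
qed

lemma monotone_iff_comparable:
  "(\<forall>p\<in>msegment x y. \<forall>q\<in>msegment x y. d x p \<le> d x q \<longrightarrow> p \<in> msegment x q) \<longleftrightarrow>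
         (\<forall>p\<in>msegment x y. \<forall>q\<in>msegment x y. p \<in> msegment x q \<or> q \<in> msegment x p)"
    (is "?mono \<longleftrightarrow> ?comp")
proof
  assume ?mono
  then show ?comp
    by (meson linear)
next
  assume ?comp
  then show ?mono
    by (metis msegment_far_point_eq msegment_iff)
qed

text \<open>
  For \<open>p, q \<in> [x,y]\<close>, transitivity of betweenness and \<open>p \<in> [x,p]\<close> make \<open>p \<in> [x,q]\<close> equivalent to
  \<open>[x,p] \<subseteq> [x,q]\<close>, so comparing points is comparing initial segments.
\<close>
lemma comparable_iff_chain:
  assumes "x \<in> M"
  shows "(\<forall>p\<in>msegment x y. \<forall>q\<in>msegment x y. p \<in> msegment x q \<or> q \<in> msegment x p) \<longleftrightarrow>
         chain\<^sub>\<subseteq> {msegment x p | p. p \<in> msegment x y}"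
proof -
  have "p \<in> msegment x q \<longleftrightarrow> msegment x p \<subseteq> msegment x q"
    if "p \<in> msegment x y" "q \<in> msegment x y" for p q
    using that assms msegment_mono[of x q p] right_end_in_msegment[of p x]
    by (auto simp: msegment_iff[of _ x y])
  then show ?thesis
    unfolding chain_subset_def by blast
qed

text \<open>
  The isometry is the distance from \<open>x\<close>: of two points of the segment, the nearer one lies between
  \<open>x\<close> and the other, so their distance is the difference of their coordinates.
\<close>
lemma monotone_imp_embeddable:
  assumes mono: "\<forall>p\<in>msegment x y. \<forall>q\<in>msegment x y. d x p \<le> d x q \<longrightarrow> p \<in> msegment x q"
  shows "isometrically_embeddable (msegment x y) d (UNIV :: real set) dist"
proof -
  have "dist (d x p) (d x q) = d p q" if pq: "p \<in> msegment x y" "q \<in> msegment x y" for p q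
  proof (cases "d x p \<le> d x q")
    case True
    with mono pq have "p \<in> msegment x q"
      by blast
    with True show ?thesis
      by (simp add: msegment_iff dist_real_def)
  next
    case False
    with mono pq have "q \<in> msegment x p"
      by simp
    with False show ?thesis
      by (simp add: msegment_iff dist_real_def commute[of p q])
  qed
  then show ?thesis
    unfolding isometrically_embeddable_def by (intro bexI[of _ "d x"]) auto
qed

lemma embeddable_imp_monotone:
  assumes "x \<in> M" "y \<in> M"
    and emb: "isometrically_embeddable (msegment x y) d (UNIV :: real set) dist"
    and pq: "p \<in> msegment x y" "q \<in> msegment x y" and le: "d x p \<le> d x q"
  shows "p \<in> msegment x q"
proof -
  obtain f :: "'a \<Rightarrow> real"
    where f: "\<And>a b. a \<in> msegment x y \<Longrightarrow> b \<in> msegment x y \<Longrightarrow> d a b = \<bar>f a - f b\<bar>"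
    using emb unfolding isometrically_embeddable_def dist_real_def by metis
  note ends = left_end_in_msegment[OF assms(1), of y] right_end_in_msegment[OF assms(2), of x]
  have "d x p + d p y = d x y" "d x q + d q y = d x y"
    using pq by (simp_all add: msegment_iff)
  \<comment> \<open>Both images lie between \<open>f x\<close> and \<open>f y\<close>, hence on the same side of \<open>f x\<close>.\<close>
  then have "\<bar>f x - f p\<bar> + \<bar>f p - f q\<bar> = \<bar>f x - f q\<bar>"
    using le unfolding f[OF ends] f[OF ends(1) pq(1)] f[OF ends(1) pq(2)]
      f[OF pq(1) ends(2)] f[OF pq(2) ends(2)]
    by linarith
  then have "d x p + d p q = d x q"
    using ends pq by (simp add: f)
  then show ?thesis
    using pq by (simp add: msegment_iff)
qed

lemma chain_iff_embeddable:
  assumes "x \<in> M" "y \<in> M"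
  shows "chain\<^sub>\<subseteq> {msegment x p | p. p \<in> msegment x y} \<longleftrightarrow>
         isometrically_embeddable (msegment x y) d (UNIV :: real set) dist"
  unfolding comparable_iff_chain[OF assms(1), symmetric] monotone_iff_comparable[symmetric]
  using monotone_imp_embeddable embeddable_imp_monotone[OF assms] by blast

lemma monotone_imp_equidistant_eq:
  assumes mono: "\<forall>p\<in>msegment x y. \<forall>q\<in>msegment x y. d x p \<le> d x q \<longrightarrow> p \<in> msegment x q"
    and "p \<in> msegment x y" "q \<in> msegment x y" "d x p = d x q"
  shows "p = q"
proof (rule msegment_far_point_eq)
  show "q \<in> M" "p \<in> msegment x q" "d x q \<le> d x p"
    using assms by (auto simp: msegment_iff[of _ x y])
qed

lemma Menger_convex_point_at_distance:
  assumes "Menger_convex" "x \<in> M" "q \<in> M" "0 \<le> t" "t \<le> d x q"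
  shows "\<exists>r\<in>msegment x q. d x r = t"
proof (cases "x = q")
  case True
  then have "t = 0" using assms by simp
  then show ?thesis
    using assms True by (auto intro!: bexI[of _ x] simp: msegment_iff)
next
  case False
  then have pos: "d x q > 0"
    using assms by simp
  then have "t / d x q \<in> {0..1}"
    using assms by simp
  then obtain r where "r \<in> M" "d x r = t / d x q * d x q" "d r q = (1 - t / d x q) * d x q"
    using assms(1-3) False unfolding Menger_convex_def by blast
  then show ?thesis
    using pos by (intro bexI[of _ r]) (simp_all add: msegment_iff algebra_simps)
qed

text \<open>
  On \<open>[x,y]\<close> the distance from \<open>x\<close> fixes the distance to \<open>y\<close>, so both points divide the segment in
  the same ratio.
\<close>
lemma strictly_convex_equidistant_eq:
  assumes "strictly_convex" "x \<in> M" "y \<in> M"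
    and pr: "p \<in> msegment x y" "r \<in> msegment x y" and eq: "d x p = d x r"
  shows "p = r"
proof (cases "x = y")
  case True
  \<comment> \<open>Strict convexity is silent here, but \<open>[x,x]\<close> is the single point \<open>x\<close>.\<close>
  have "z = x" if "z \<in> msegment x y" for z
    using that assms(2) True msegment_far_point_eq[of x z x] by simp
  from this[OF pr(1)] this[OF pr(2)] show ?thesis
    by simp
next
  case False
  define \<alpha> where "\<alpha> = d x p / d x y"
  have pos: "d x y > 0"
    using assms False by simp
  have sums: "d x p + d p y = d x y" "d x r + d r y = d x y"
    using pr by (simp_all add: msegment_iff)
  then have "d x p \<le> d x y"
    using nonneg[of p y] by linarith
  then have "\<alpha> \<in> {0..1}"
    using pos by (simp add: \<alpha>_def)
  then have "\<exists>!z. z \<in> M \<and> d x z = \<alpha> * d x y \<and> d z y = (1 - \<alpha>) * d x y"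
    using assms(1-3) False unfolding strictly_convex_def by blast
  moreover have "\<alpha> * d x y = d x p" "(1 - \<alpha>) * d x y = d x y - d x p"
    using pos by (simp_all add: \<alpha>_def algebra_simps)
  ultimately have "\<exists>!z. z \<in> M \<and> d x z = d x p \<and> d z y = d x y - d x p"
    by simp
  moreover have "p \<in> M" "d p y = d x y - d x p" "r \<in> M" "d r y = d x y - d x p"
    using pr sums eq by (auto simp: msegment_iff)
  ultimately show ?thesis
    using eq by metis
qed

text \<open>
  For the forward direction, Menger convexity of the smaller segment \<open>[x,q]\<close> places a point on it at
  distance \<open>d x p\<close> from \<open>x\<close>; uniqueness on the larger segment \<open>[x,y]\<close> identifies it with \<open>p\<close>.
\<close>
lemma strictly_convex_iff_monotone:
  assumes "Menger_convex"
  shows "strictly_convex \<longleftrightarrow>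
    (\<forall>x\<in>M. \<forall>y\<in>M. \<forall>p\<in>msegment x y. \<forall>q\<in>msegment x y. d x p \<le> d x q \<longrightarrow> p \<in> msegment x q)"
    (is "_ \<longleftrightarrow> ?mono")
proof
  assume sc: strictly_convex
  show ?mono
  proof (intro ballI impI)
    fix x y p q
    assume xy: "x \<in> M" "y \<in> M" and pq: "p \<in> msegment x y" "q \<in> msegment x y"
      and le: "d x p \<le> d x q"
    have "q \<in> M"
      using pq by (simp add: msegment_iff)
    then obtain r where r: "r \<in> msegment x q" "d x r = d x p"
      using Menger_convex_point_at_distance[OF assms xy(1) _ nonneg le] by blast
    then have "p = r"
      using strictly_convex_equidistant_eq[OF sc xy pq(1)] msegment_mono[OF xy pq(2)] by auto
    with r show "p \<in> msegment x q"
      by simp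
  qed
next
  assume mono: ?mono
  show strictly_convex
    unfolding strictly_convex_def
  proof (intro ballI impI ex_ex1I)
    fix x y and \<alpha> :: real
    assume "x \<in> M" "y \<in> M" "x \<noteq> y" "\<alpha> \<in> {0..1}"
    then show "\<exists>z. z \<in> M \<and> d x z = \<alpha> * d x y \<and> d z y = (1 - \<alpha>) * d x y"
      using assms unfolding Menger_convex_def by blast
  next
    fix x y p q and \<alpha> :: real
    assume xy: "x \<in> M" "y \<in> M"
      and p: "p \<in> M \<and> d x p = \<alpha> * d x y \<and> d p y = (1 - \<alpha>) * d x y"
      and q: "q \<in> M \<and> d x q = \<alpha> * d x y \<and> d q y = (1 - \<alpha>) * d x y"
    have "p \<in> msegment x y" "q \<in> msegment x y" "d x p = d x q"
      using p q by (simp_all add: msegment_iff algebra_simps)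
    then show "p = q"
      using monotone_imp_equidistant_eq mono xy by blast
  qed
qed

end

theorem theorem3p3:
  fixes M :: "'a set" and d :: "'a \<Rightarrow> 'a \<Rightarrow> real"
  assumes "Metric_space M d"
    and "Metric_space.Menger_convex M d"
  shows
    "let seg = Metric_space.msegment M d;
         cond_i = (\<forall>x\<in>M. \<forall>y\<in>M. \<forall>p\<in>seg x y. \<forall>q\<in>seg x y. d x p \<le> d x q \<longrightarrow> p \<in> seg x q);
         cond_ii = (\<forall>x\<in>M. \<forall>y\<in>M. \<forall>p\<in>seg x y. \<forall>q\<in>seg x y. p \<in> seg x q \<or> q \<in> seg x p);
         cond_iii = (\<forall>x\<in>M. \<forall>y\<in>M. chain\<^sub>\<subseteq> {seg x p | p. p \<in> seg x y});
         cond_iv = (\<forall>x\<in>M. \<forall>y\<in>M. isometrically_embeddable (seg x y) d (UNIV :: real set) dist)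
     in (cond_i \<longleftrightarrow> cond_ii) \<and> (cond_ii \<longleftrightarrow> cond_iii) \<and> (cond_iii \<longleftrightarrow> cond_iv) \<and>
        (Metric_space.strictly_convex M d \<longleftrightarrow> cond_i)"
proof -
  interpret Metric_space M d
    by (fact assms(1))
  show ?thesis
    unfolding Let_def
    by (intro conjI strictly_convex_iff_monotone[OF assms(2)] ball_cong refl
        monotone_iff_comparable comparable_iff_chain chain_iff_embeddable)
qed

end
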